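(* Let $G$ be a claw-free graph of maximum degree $\Delta$. Then $\operatorname{lbox}(G)\le 2\Delta$.
   Context: All graphs are finite, simple and undirected. A graph is claw-free if it has no induced subgraph isomorphic to the complete bipartite graph $K_{1,3}$. An interval graph is a graph whose vertices can be mapped to closed intervals of the real line so that two distinct vertices are adjacent if and only if their intervals intersect. For graphs $G, I_1,\dots,I_k$ on the same vertex set, $G=\bigcap_{i=1}^k I_i$ means $E(G)=E(I_1)\cap\cdots\cap E(I_k)$. A vertex is universal in a graph if it is adjacent to all other vertices of that graph, and non-universal otherwise. The local boxicity $\operatorname{lbox}(G)$ is the smallest positive integer $l$ such that, for some $k$, $G=\bigcap_{i=1}^k I_i$ where each $I_i$ is an interval graph on $V(G)$ and each vertex of $G$ is a non-universal vertex in at most $l$ of the graphs $I_1,\dots,I_k$.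
   Formalization: The maximum degree Δ is assumed to be at least 1: for Δ = 0 (edgeless graphs, which are claw-free) the claim fails, since the local boxicity is by definition a positive integer and so exceeds 2Δ = 0. *)

theory Defs
  imports "HOL-Analysis.Analysis" "Graph_Theory.Graph_Theory"
begin

text \<open>
  A finite simple undirected graph is a \<^locale>\<open>pair_graph\<close>: a finite, loop-free, symmetric
  digraph without parallel arcs. An edge joining \<open>u\<close> and \<open>v\<close> is represented by the two arcs
  \<open>(u, v)\<close> and \<open>(v, u)\<close>, so the degree of a vertex is its out-degree, and intersecting edge
  sets amounts to intersecting the symmetric arc sets.
\<close>

text \<open>The graph without vertices has maximum degree 0.\<close>
definition max_degree :: "'a pair_pre_digraph \<Rightarrow> nat" where
  "max_degree G = Max (insert 0 (out_degree (with_proj G) ` pverts G))"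

definition claw_free :: "'a pair_pre_digraph \<Rightarrow> bool" where
  "claw_free G \<longleftrightarrow>
     \<not> (\<exists>H :: 'a pair_pre_digraph.
          induced_subgraph (with_proj H) (with_proj G) \<and> K\<^bsub>1,3\<^esub> (with_proj H))"

text \<open>
  The vertex \<open>v\<close> is mapped to the interval \<open>{l v..r v}\<close>; requiring \<open>l v \<le> r v\<close> excludes the
  empty interval.
\<close>
definition interval_graph :: "'a pair_pre_digraph \<Rightarrow> bool" where
  "interval_graph G \<longleftrightarrow> pair_graph G \<and>
     (\<exists>l r :: 'a \<Rightarrow> real.
        (\<forall>v \<in> pverts G. l v \<le> r v) \<and>
        (\<forall>u \<in> pverts G. \<forall>v \<in> pverts G. u \<noteq> v \<longrightarrow>
           ((u, v) \<in> parcs G \<longleftrightarrow> {l u..r u} \<inter> {l v..r v} \<noteq> {})))"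

definition universal :: "'a pair_pre_digraph \<Rightarrow> 'a \<Rightarrow> bool" where
  "universal G v \<longleftrightarrow> v \<in> pverts G \<and> (\<forall>u \<in> pverts G. u \<noteq> v \<longrightarrow> (v, u) \<in> parcs G)"

definition is_intersection_of ::
    "'a pair_pre_digraph \<Rightarrow> nat \<Rightarrow> (nat \<Rightarrow> 'a pair_pre_digraph) \<Rightarrow> bool" where
  "is_intersection_of G k I \<longleftrightarrow>
     0 < k \<and> (\<forall>i<k. pverts (I i) = pverts G) \<and> parcs G = (\<Inter>i<k. parcs (I i))"

definition lbox :: "'a pair_pre_digraph \<Rightarrow> nat" where
  "lbox G = (LEAST l. 0 < l \<and>
     (\<exists>k I. is_intersection_of G k I \<and> (\<forall>i<k. interval_graph (I i)) \<and>
        (\<forall>v \<in> pverts G. card {i. i < k \<and> \<not> universal (I i) v} \<le> l)))"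

end

theory Submission
  imports Defs
begin

text \<open>
  Colour \<open>G\<close> greedily with \<open>\<Delta> + 1\<close> colours. Since \<open>G\<close> is claw-free, a vertex has at most two
  neighbours of any given colour, so any two colour classes together induce a graph of maximum
  degree at most 2, which is an intersection of two interval graphs. Adding all other vertices as
  universal vertices and intersecting over all pairs of colours yields \<open>G\<close>, and a vertex is
  non-universal only in the two graphs for each of the \<open>\<Delta>\<close> pairs that contain its colour.
\<close>

section \<open>Greedy colouring\<close>

text \<open>When \<open>x\<close> joins, its at most \<open>d\<close> earlier neighbours block at
  most \<open>d\<close> of the \<open>d + 1\<close> colours 0, ..., \<open>d\<close>, so one is
  left. Degrees are counted inside \<open>V\<close>, so that the bound is inherited by
  subsets.\<close>

lemma greedy_colouring:
  assumes "finite V" and "sym E" and "irrefl E"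
    and "\<And>v. v \<in> V \<Longrightarrow> card {u \<in> V. (v, u) \<in> E} \<le> d"
  shows "\<exists>c :: 'a \<Rightarrow> nat. (\<forall>v\<in>V. c v \<le> d) \<and> (\<forall>u\<in>V. \<forall>v\<in>V. (u, v) \<in> E \<longrightarrow> c u \<noteq> c v)"
  using assms(1,4)
proof (induction V rule: finite_induct)
  case empty
  then show ?case by simp
next
  case (insert x V)
  have "card {u \<in> V. (v, u) \<in> E} \<le> d" if "v \<in> V" for v
  proof -
    have "card {u \<in> V. (v, u) \<in> E} \<le> card {u \<in> insert x V. (v, u) \<in> E}"
      using insert.hyps by (intro card_mono) auto
    also have "\<dots> \<le> d" using insert.prems that by blast
    finally show ?thesis .
  qed
  then obtain c :: "'a \<Rightarrow> nat" where c: "\<forall>v\<in>V. c v \<le> d"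
    "\<forall>u\<in>V. \<forall>v\<in>V. (u, v) \<in> E \<longrightarrow> c u \<noteq> c v"
    using insert.IH by blast
  let ?N = "{u \<in> V. (x, u) \<in> E}"
  have "card (c ` ?N) \<le> card ?N" using insert.hyps by (intro card_image_le) simp
  also have "\<dots> \<le> card {u \<in> insert x V. (x, u) \<in> E}"
    using insert.hyps by (intro card_mono) auto
  also have "\<dots> \<le> d" using insert.prems by blast
  finally have "card (c ` ?N) < card {..d}" by simp
  then have "\<not> {..d} \<subseteq> c ` ?N"
    using insert.hyps card_mono[of "c ` ?N" "{..d}"] by auto
  then obtain k where k: "k \<le> d" "k \<notin> c ` ?N" by blast
  have "\<forall>v\<in>insert x V. (c(x := k)) v \<le> d" using c k by simp
  moreover have "\<forall>u\<in>insert x V. \<forall>v\<in>insert x V. (u, v) \<in> E \<longrightarrow> (c(x := k)) u \<noteq> (c(x := k)) v"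
    using c k \<open>irrefl E\<close> symD[OF \<open>sym E\<close>] by (auto simp: irrefl_def)
  ultimately show ?case by blast
qed

section \<open>Graphs of maximum degree at most two\<close>

lemma not_three_neighbours:
  assumes "finite W" and "card {y \<in> W. (x, y) \<in> E} \<le> 2"
    and "a \<in> W" "b \<in> W" "c \<in> W" and "(x, a) \<in> E" "(x, b) \<in> E" "(x, c) \<in> E"
    and "a \<noteq> b" "a \<noteq> c" "b \<noteq> c"
  shows False
proof -
  have "card {a, b, c} \<le> card {y \<in> W. (x, y) \<in> E}"
    using assms by (intro card_mono) auto
  then show False using assms by simp
qed

text \<open>The path below is a longest one. It spans a connected component; if that component is a
  cycle, the edge closing it joins \<open>xs ! 0\<close> to the last vertex, which is why \<open>i \<ge> 1\<close>.\<close>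

lemma spanning_path_of_component:
  assumes W: "finite W" "W \<noteq> {}" and "sym E"
    and deg: "\<And>x. x \<in> W \<Longrightarrow> card {y \<in> W. (x, y) \<in> E} \<le> 2"
  shows "\<exists>xs. xs \<noteq> [] \<and> distinct xs \<and> set xs \<subseteq> W \<and>
    (\<forall>x\<in>set xs. \<forall>y\<in>W - set xs. (x, y) \<notin> E) \<and>
    (\<forall>i\<ge>1. \<forall>j<length xs. i < j \<longrightarrow> ((xs ! i, xs ! j) \<in> E \<longleftrightarrow> j = Suc i))"
proof -
  define path where "path xs \<longleftrightarrow>
    xs \<noteq> [] \<and> distinct xs \<and> set xs \<subseteq> W \<and> successively (\<lambda>x y. (x, y) \<in> E) xs" for xs
  obtain w where "w \<in> W" using W by blast
  then have "path [w]" by (simp add: path_def)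
  \<comment> \<open>A path has no repeated vertex, so lengths are bounded and a longest path
    exists.\<close>
  moreover have "length xs < Suc (card W)" if "path xs" for xs
    using that card_mono[OF W(1), of "set xs"] by (simp add: path_def distinct_card)
  ultimately obtain xs where xs: "path xs" and longest: "\<And>ys. path ys \<Longrightarrow> length ys \<le> length xs"
    using ex_has_greatest_nat[of path "[w]" length] by blast
  note p = xs[unfolded path_def]
  have next_edge: "(xs ! i, xs ! Suc i) \<in> E" if "Suc i < length xs" for i
    using p that by (simp add: successively_conv_nth)
  have prev_edge: "(xs ! Suc i, xs ! i) \<in> E" if "Suc i < length xs" for i
    using next_edge[OF that] \<open>sym E\<close> by (meson symD)
  have in_W: "xs ! i \<in> W" if "i < length xs" for i
    using p that nth_mem by blast
  have ne: "xs ! i \<noteq> xs ! j" if "i < length xs" "j < length xs" "i \<noteq> j" for i j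
    using p that by (simp add: nth_eq_iff_index_eq)
  \<comment> \<open>An end of the path with a neighbour off the path would prolong it; an inner
    vertex would acquire a third neighbour.\<close>
  have "(x, y) \<notin> E" if x: "x \<in> set xs" and y: "y \<in> W - set xs" for x y
  proof
    assume xy: "(x, y) \<in> E"
    obtain i where i: "i < length xs" "x = xs ! i" using x by (auto simp: in_set_conv_nth)
    consider "i = 0" | "Suc i = length xs" | "0 < i" "Suc i < length xs"
      using i by linarith
    then show False
    proof cases
      case 1
      then have "x = hd xs" using i p by (simp add: hd_conv_nth)
      then have "path (y # xs)"
        using p y xy \<open>sym E\<close> by (auto simp: path_def successively_Cons dest: symD)
      then show False using longest by fastforce
    next
      case 2
      then have "x = last xs" using i p by (metis diff_Suc_1 last_conv_nth)
      then have "path (xs @ [y])"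
        using p y xy by (auto simp: path_def successively_append_iff)
      then show False using longest by fastforce
    next
      case 3
      then obtain h where h: "i = Suc h" by (cases i) auto
      have "xs ! k \<noteq> y" if "k < length xs" for k using that y by auto
      then show False
        using not_three_neighbours[OF W(1) deg, of x "xs ! h" "xs ! Suc i" y]
          3 i h xy y next_edge prev_edge in_W ne by auto
    qed
  qed
  \<comment> \<open>From \<open>i \<ge> 1\<close> on there is a predecessor. Were \<open>j\<close>
    beyond \<open>Suc i\<close>, there would be a successor as well, and \<open>xs ! j\<close> would
    be a third neighbour.\<close>
  moreover have "(xs ! i, xs ! j) \<in> E \<longleftrightarrow> j = Suc i" if ij: "1 \<le> i" "i < j" "j < length xs" for i j
  proof
    assume e: "(xs ! i, xs ! j) \<in> E"
    obtain h where h: "i = Suc h" using ij by (cases i) auto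
    show "j = Suc i"
    proof (rule ccontr)
      assume "j \<noteq> Suc i"
      then show False
        using not_three_neighbours[OF W(1) deg, of "xs ! i" "xs ! h" "xs ! Suc i" "xs ! j"]
          h e ij next_edge[of i] prev_edge[of h] in_W ne by auto
    qed
  qed (use next_edge ij in auto)
  ultimately show ?thesis using p by blast
qed

text \<open>Components are split off one at a time, each with a spanning path, and induction handles
  the rest. The index \<open>b\<close> selects one of two dimensions; a single one would not do,
  since a cycle of length at least four is not an interval graph. Nonempty intervals meet iff
  neither starts after the other ends.\<close>

lemma boxicity_two_if_degree_le_two:
  assumes "finite W" and "sym E"
    and "\<And>x. x \<in> W \<Longrightarrow> card {y \<in> W. (x, y) \<in> E} \<le> 2"
  shows "\<exists>l r :: bool \<Rightarrow> 'a \<Rightarrow> real. (\<forall>b. \<forall>v\<in>W. l b v \<le> r b v) \<and>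
    (\<forall>u\<in>W. \<forall>v\<in>W. u \<noteq> v \<longrightarrow> ((u, v) \<in> E \<longleftrightarrow> (\<forall>b. l b u \<le> r b v \<and> l b v \<le> r b u)))"
  using assms(1,3)
proof (induction W rule: finite_psubset_induct)
  case (psubset W)
  show ?case
  proof (cases "W = {}")
    case False
    obtain xs where xs: "xs \<noteq> []" "distinct xs" "set xs \<subseteq> W"
      and closed: "\<And>x y. x \<in> set xs \<Longrightarrow> y \<in> W - set xs \<Longrightarrow> (x, y) \<notin> E"
      and inner: "\<And>i j. 1 \<le> i \<Longrightarrow> j < length xs \<Longrightarrow> i < j \<Longrightarrow> (xs ! i, xs ! j) \<in> E \<longleftrightarrow> j = Suc i"
      using spanning_path_of_component[OF psubset.hyps(1) False \<open>sym E\<close> psubset.prems] by blast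
    define U where "U = W - set xs"
    have U: "U \<subset> W" using xs False by (cases xs) (auto simp: U_def)
    have U_deg: "card {y \<in> U. (x, y) \<in> E} \<le> 2" if "x \<in> U" for x
    proof -
      have "card {y \<in> U. (x, y) \<in> E} \<le> card {y \<in> W. (x, y) \<in> E}"
        using psubset.hyps by (intro card_mono) (auto simp: U_def)
      also have "\<dots> \<le> 2" using psubset.prems that by (auto simp: U_def)
      finally show ?thesis .
    qed
    obtain l r :: "bool \<Rightarrow> 'a \<Rightarrow> real" where lr: "\<forall>b. \<forall>v\<in>U. l b v \<le> r b v"
      "\<forall>u\<in>U. \<forall>v\<in>U. u \<noteq> v \<longrightarrow> ((u, v) \<in> E \<longleftrightarrow> (\<forall>b. l b u \<le> r b v \<and> l b v \<le> r b u))"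
      using psubset.IH[OF U U_deg] by metis
    define pos where "pos = the_inv_into {..<length xs} ((!) xs)"
    have "inj_on ((!) xs) {..<length xs}" using xs by (simp add: inj_on_nth)
    then have pos: "pos (xs ! i) = i" if "i < length xs" for i
      using that by (simp add: pos_def the_inv_into_f_f)
    have pos_less: "pos x < length xs" and nth_pos: "xs ! pos x = x" if "x \<in> set xs" for x
      using that pos by (auto simp: in_set_conv_nth)
    have "finite (r True ` U)" using psubset.hyps by (simp add: U_def)
    \<comment> \<open>\<open>M\<close> exceeds every right end already used in dimension
      \<open>True\<close>. The new component starts at \<open>M\<close>, so this dimension alone
      separates it from \<open>U\<close>.\<close>
    then obtain M where M: "\<forall>v\<in>U. r True v < M"
      using bdd_above_finite[of "r True ` U"] unfolding bdd_above_def
      by (metis imageI le_less_trans less_add_one)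
    let ?x0 = "xs ! 0"
    text \<open>In the first dimension the path is laid out as consecutive intervals, with \<open>?x0\<close> meeting
      all of them; the second dimension only separates \<open>?x0\<close> from its non-neighbours.\<close>
    define l' where "l' b v = (if v \<in> U then l b v else if b then M + real (pos v)
      else if v = ?x0 \<or> (?x0, v) \<in> E then 0 else 1)" for b v
    define r' where "r' b v = (if v \<in> U then r b v else
      if b then (if v = ?x0 then M + real (length xs) else M + real (pos v) + 1)
      else if v = ?x0 then 0 else 1)" for b v
    have meet_sym: "(\<forall>b. l' b u \<le> r' b v \<and> l' b v \<le> r' b u) \<longleftrightarrow>
        (\<forall>b. l' b v \<le> r' b u \<and> l' b u \<le> r' b v)" for u v by blast
    have x0: "?x0 \<in> set xs" "pos ?x0 = 0" using xs pos by auto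
    have path_edge: "(u, v) \<in> E \<longleftrightarrow> (\<forall>b. l' b u \<le> r' b v \<and> l' b v \<le> r' b u)"
      if uv: "u \<in> set xs" "v \<in> set xs" "pos u < pos v" for u v
    proof -
      have "v \<noteq> ?x0" using uv x0 by auto
      \<comment> \<open>If \<open>u\<close> is \<open>?x0\<close>, the intervals always meet in
        dimension \<open>True\<close>, and \<open>False\<close> decides. Otherwise both intervals
        contain 1 in dimension \<open>False\<close>, and the unit intervals in \<open>True\<close>
        touch exactly for consecutive positions.\<close>
      show ?thesis
      proof (cases "u = ?x0")
        case True
        then show ?thesis
          using uv x0 pos_less[OF uv(2)] \<open>v \<noteq> ?x0\<close> by (auto simp: l'_def r'_def U_def all_bool_eq)
      next
        case False
        then have "1 \<le> pos u" using nth_pos[OF uv(1)] by (cases "pos u") auto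
        then have "(u, v) \<in> E \<longleftrightarrow> pos v = Suc (pos u)"
          using inner[of "pos u" "pos v"] uv pos_less nth_pos by simp
        also have "\<dots> \<longleftrightarrow> (\<forall>b. l' b u \<le> r' b v \<and> l' b v \<le> r' b u)"
          using uv False \<open>v \<noteq> ?x0\<close> by (auto simp: l'_def r'_def U_def all_bool_eq)
        finally show ?thesis .
      qed
    qed
    have far: "(u, v) \<in> E \<longleftrightarrow> (\<forall>b. l' b u \<le> r' b v \<and> l' b v \<le> r' b u)"
      if "u \<in> set xs" "v \<in> U" for u v
    proof -
      have "r True v < M" using M that by blast
      then have "r' True v < l' True u" using that by (simp add: l'_def r'_def U_def)
      then have "\<not> (\<forall>b. l' b u \<le> r' b v \<and> l' b v \<le> r' b u)" by (meson not_le)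
      then show ?thesis using closed that by (auto simp: U_def)
    qed
    have flip: "(u, v) \<in> E \<longleftrightarrow> (v, u) \<in> E" for u v using \<open>sym E\<close> by (meson symD)
    have "(u, v) \<in> E \<longleftrightarrow> (\<forall>b. l' b u \<le> r' b v \<and> l' b v \<le> r' b u)"
      if uv: "u \<in> W" "v \<in> W" "u \<noteq> v" for u v
    proof -
      consider "u \<in> U" "v \<in> U" | "u \<in> set xs" "v \<in> U" | "u \<in> U" "v \<in> set xs"
        | "u \<in> set xs" "v \<in> set xs" "pos u < pos v" | "u \<in> set xs" "v \<in> set xs" "pos v < pos u"
        using uv nth_pos[of u] nth_pos[of v] by (cases "pos u" "pos v" rule: linorder_cases)
          (auto simp: U_def)
      then show ?thesis
      proof cases
        case 1
        then show ?thesis using lr(2) uv(3) by (simp add: l'_def r'_def)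
      next
        case 3
        then show ?thesis using far[of v u] flip meet_sym by blast
      next
        case 5
        then show ?thesis using path_edge[of v u] flip meet_sym by blast
      qed (use far path_edge in blast)+
    qed
    moreover have "\<forall>b. \<forall>v\<in>W. l' b v \<le> r' b v"
      using lr(1) x0(2) by (auto simp: l'_def r'_def)
    ultimately show ?thesis by blast
  qed simp
qed

section \<open>Claws and independent sets\<close>

text \<open>Three neighbours of \<open>v\<close> in \<open>S\<close> are pairwise nonadjacent, so
  with \<open>v\<close> as centre they would induce a claw.\<close>

lemma card_neighbours_in_independent_le_two:
  assumes "pair_graph G" and "claw_free G"
    and indep: "\<And>u w. u \<in> S \<Longrightarrow> w \<in> S \<Longrightarrow> (u, w) \<notin> parcs G"
  shows "card {u \<in> S. (v, u) \<in> parcs G} \<le> 2"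
proof (rule ccontr)
  interpret pair_graph G by fact
  assume "\<not> ?thesis"
  then have "3 \<le> card {u \<in> S. (v, u) \<in> parcs G}" by simp
  then obtain A where A: "A \<subseteq> {u \<in> S. (v, u) \<in> parcs G}" "card A = 3" "finite A"
    by (rule obtain_subset_with_card_n)
  define H where "H = \<lparr>pverts = insert v A, parcs = {v} \<times> A \<union> A \<times> {v}\<rparr>"
  have flip: "(u, w) \<in> parcs G \<Longrightarrow> (w, u) \<in> parcs G" for u w
    using graph_symmetric by simp
  have vA: "v \<notin> A" using A indep pair_no_loops by fastforce
  then have "finite (pverts H)" "pverts H = {v} \<union> A" "{v} \<inter> A = {}" "card {v} = 1"
    "parcs H = {v} \<times> A \<union> A \<times> {v}"
    using A by (simp_all add: H_def)
  then have K: "K\<^bsub>1,3\<^esub> (with_proj H)"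
    unfolding complete_bipartite_digraph_pair_def using \<open>card A = 3\<close> by blast
  then interpret H: graph "with_proj H" by (simp add: complete_bipartite_digraph_def)
  \<comment> \<open>\<open>v\<close> is known to be a vertex of \<open>G\<close> only as the
    endpoint of an arc to some leaf.\<close>
  have "A \<noteq> {}" using \<open>card A = 3\<close> by auto
  then have "pverts H \<subseteq> pverts G"
    using A(1) in_arcsD1 in_arcsD2 by (auto simp: H_def)
  moreover have "parcs H = {e \<in> parcs G. fst e \<in> pverts H \<and> snd e \<in> pverts H}"
    using A indep flip vA pair_no_loops by (fastforce simp: H_def)
  ultimately have "induced_subgraph (with_proj H) (with_proj G)"
    using wf_digraph_axioms H.wf_digraph_axioms
    by (auto simp: induced_subgraph_def subgraph_def compatible_def)
  then show False using K \<open>claw_free G\<close> by (auto simp: claw_free_def)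
qed

section \<open>Interval graphs with added universal vertices\<close>

text \<open>Vertices outside \<open>W\<close> are joined to everything by decree, so that
  \<open>l\<close> and \<open>r\<close> matter only on \<open>W\<close> and no intervals need to be
  chosen elsewhere.\<close>

definition interval_extension ::
    "'a set \<Rightarrow> 'a set \<Rightarrow> ('a \<Rightarrow> real) \<Rightarrow> ('a \<Rightarrow> real) \<Rightarrow> 'a pair_pre_digraph" where
  "interval_extension V W l r = \<lparr>pverts = V,
     parcs = {(u, v) \<in> V \<times> V. u \<noteq> v \<and> (u \<in> W \<and> v \<in> W \<longrightarrow> l u \<le> r v \<and> l v \<le> r u)}\<rparr>"

lemma universal_interval_extension:
  "v \<in> V - W \<Longrightarrow> universal (interval_extension V W l r) v"
  by (auto simp: universal_def interval_extension_def)

lemma interval_graph_interval_extension: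
  assumes "finite V" and lr: "\<And>v. v \<in> V \<inter> W \<Longrightarrow> l v \<le> r v"
  shows "interval_graph (interval_extension V W l r)"
proof -
  let ?G = "interval_extension V W l r"
  have "parcs ?G \<subseteq> V \<times> V" by (auto simp: interval_extension_def)
  then have "finite (parcs ?G)" using \<open>finite V\<close> finite_subset by blast
  then have "pair_graph ?G"
    using \<open>finite V\<close>
    by unfold_locales (auto simp: interval_extension_def symmetric_def intro!: symI)
  moreover
  obtain M where M: "\<And>v. v \<in> V \<Longrightarrow> \<bar>l v\<bar> + \<bar>r v\<bar> \<le> M"
    using bdd_above_finite[of "(\<lambda>v. \<bar>l v\<bar> + \<bar>r v\<bar>) ` V"] \<open>finite V\<close>
    by (auto simp: bdd_above_def)
  \<comment> \<open>Vertices outside \<open>W\<close> receive an interval that contains all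
    endpoints of the others. The absolute value makes it nonempty whatever the sign of
    \<open>M\<close>.\<close>
  define l' r' where "l' v = (if v \<in> W then l v else - \<bar>M\<bar>)"
    and "r' v = (if v \<in> W then r v else \<bar>M\<bar>)" for v
  have "\<forall>v\<in>V. l' v \<le> r' v" using lr by (auto simp: l'_def r'_def)
  moreover have "(u, v) \<in> parcs ?G \<longleftrightarrow> {l' u..r' u} \<inter> {l' v..r' v} \<noteq> {}"
    if uv: "u \<in> V" "v \<in> V" "u \<noteq> v" for u v
  proof -
    have "{l' u..r' u} \<inter> {l' v..r' v} \<noteq> {} \<longleftrightarrow> l' u \<le> r' v \<and> l' v \<le> r' u"
      using \<open>\<forall>v\<in>V. l' v \<le> r' v\<close> uv by (auto simp: Int_atLeastAtMost)
    also have "\<dots> \<longleftrightarrow> (u \<in> W \<and> v \<in> W \<longrightarrow> l u \<le> r v \<and> l v \<le> r u)"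
      using M[of u] M[of v] uv by (auto simp: l'_def r'_def)
    finally show ?thesis using uv by (auto simp: interval_extension_def)
  qed
  moreover have "pverts ?G = V" by (simp add: interval_extension_def)
  ultimately show ?thesis unfolding interval_graph_def by metis
qed

section \<open>Bounding local boxicity by counting\<close>

text \<open>Any enumeration of \<open>S\<close> turns the family into one indexed by an initial
  segment of the naturals, as \<open>lbox\<close> demands; this allows indexing by pairs of
  colours.\<close>

lemma lbox_le_of_finite_family:
  fixes I :: "'i \<Rightarrow> 'a pair_pre_digraph"
  assumes "finite S" "S \<noteq> {}" and "0 < d"
    and "\<And>s. s \<in> S \<Longrightarrow> pverts (I s) = pverts G" and "parcs G = (\<Inter>s\<in>S. parcs (I s))"
    and "\<And>s. s \<in> S \<Longrightarrow> interval_graph (I s)"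
    and d: "\<And>v. v \<in> pverts G \<Longrightarrow> card {s \<in> S. \<not> universal (I s) v} \<le> d"
  shows "lbox G \<le> d"
proof -
  obtain f where f: "bij_betw f {..<card S} S"
    using ex_bij_betw_nat_finite[OF \<open>finite S\<close>] by (auto simp: atLeast0LessThan)
  have f_in: "f i \<in> S" if "i < card S" for i using f that by (auto simp: bij_betw_def)
  have "is_intersection_of G (card S) (I \<circ> f)"
  proof -
    have "(\<Inter>i<card S. parcs ((I \<circ> f) i)) = (\<Inter>s\<in>f ` {..<card S}. parcs (I s))" by simp
    also have "f ` {..<card S} = S" using f by (simp add: bij_betw_def)
    finally show ?thesis
      using assms f_in by (simp add: is_intersection_of_def card_gt_0_iff)
  qed
  moreover have "card {i. i < card S \<and> \<not> universal ((I \<circ> f) i) v} \<le> d" if "v \<in> pverts G" for v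
  proof -
    have "inj_on f {i. i < card S \<and> \<not> universal ((I \<circ> f) i) v}"
      using f by (auto simp: bij_betw_def intro: inj_on_subset)
    moreover have "f ` {i. i < card S \<and> \<not> universal ((I \<circ> f) i) v} \<subseteq> {s \<in> S. \<not> universal (I s) v}"
      using f_in by auto
    ultimately have "card {i. i < card S \<and> \<not> universal ((I \<circ> f) i) v}
        \<le> card {s \<in> S. \<not> universal (I s) v}"
      using \<open>finite S\<close> by (intro card_inj_on_le) auto
    then show ?thesis using d[OF that] by linarith
  qed
  ultimately show ?thesis
    using f_in assms unfolding lbox_def
    by (intro Least_le conjI exI[of _ "card S"] exI[of _ "I \<circ> f"]) auto
qed

text \<open>A doubleton containing \<open>a\<close> is determined by its other element, and the
  boolean doubles the count.\<close>

lemma card_doubletons_containing_le: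
  assumes "a \<in> A" "finite A"
  shows "card {(e, b :: bool). e \<subseteq> A \<and> card e = 2 \<and> a \<in> e} \<le> 2 * (card A - 1)"
proof -
  have "{(e, b :: bool). e \<subseteq> A \<and> card e = 2 \<and> a \<in> e}
      \<subseteq> (\<lambda>(j, b). ({a, j}, b)) ` ((A - {a}) \<times> UNIV)"
    by (auto simp: card_2_iff image_iff)
  then have "card {(e, b :: bool). e \<subseteq> A \<and> card e = 2 \<and> a \<in> e} \<le> card ((A - {a}) \<times> (UNIV :: bool set))"
    using assms by (intro surj_card_le) auto
  then show ?thesis using assms by (simp add: card_cartesian_product)
qed

section \<open>Intersection over all pairs of colours\<close>

theorem corollary12:
  fixes G :: "'a pair_pre_digraph" and \<Delta> :: nat
  assumes "pair_graph G"
    and "claw_free G"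
    and "max_degree G = \<Delta>"
    and "\<Delta> \<ge> 1"
  shows "lbox G \<le> 2 * \<Delta>"
proof -
  interpret pair_graph G by fact
  let ?V = "pverts G" and ?E = "parcs G"
  have E: "sym ?E" "irrefl ?E"
    using graph_symmetric pair_no_loops by (fastforce intro!: symI simp: irrefl_def)+
  have deg_le: "card {u \<in> ?V. (v, u) \<in> ?E} \<le> \<Delta>" if "v \<in> ?V" for v
  proof -
    have "card {u \<in> ?V. (v, u) \<in> ?E} \<le> card (out_arcs (with_proj G) v)"
      by (rule card_inj_on_le[of "Pair v"]) (auto simp: inj_on_def)
    also have "\<dots> \<le> max_degree G"
      unfolding max_degree_def out_degree_def[symmetric]
      using that pair_finite_verts by (intro Max_ge) auto
    finally show ?thesis using \<open>max_degree G = \<Delta>\<close> by simp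
  qed
  obtain c :: "'a \<Rightarrow> nat" where c: "\<And>v. v \<in> ?V \<Longrightarrow> c v \<le> \<Delta>"
    and proper: "\<And>u v. u \<in> ?V \<Longrightarrow> v \<in> ?V \<Longrightarrow> (u, v) \<in> ?E \<Longrightarrow> c u \<noteq> c v"
    using greedy_colouring[OF pair_finite_verts E deg_le] by metis
  define W where "W e = {v \<in> ?V. c v \<in> e}" for e
  have fin_W: "finite (W e)" for e using pair_finite_verts by (simp add: W_def)
  have deg: "card {y \<in> W e. (x, y) \<in> ?E} \<le> 2" if "card e = 2" "x \<in> W e" for e x
  proof -
    obtain j where e: "e = {c x, j}"
      using \<open>card e = 2\<close> \<open>x \<in> W e\<close> by (auto simp: W_def card_2_iff)
    \<comment> \<open>No neighbour of \<open>x\<close> shares its colour, so those in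
      \<open>W e\<close> all lie in the independent class of the other colour
      \<open>j\<close>.\<close>
    have "{y \<in> W e. (x, y) \<in> ?E} \<subseteq> {y \<in> W {j}. (x, y) \<in> ?E}"
      using proper[of x] \<open>x \<in> W e\<close> by (fastforce simp: W_def e)
    then have "card {y \<in> W e. (x, y) \<in> ?E} \<le> card {y \<in> W {j}. (x, y) \<in> ?E}"
      using fin_W by (intro card_mono) auto
    also have "\<dots> \<le> 2"
    proof (rule card_neighbours_in_independent_le_two[OF assms(1,2)])
      show "(u, w) \<notin> ?E" if "u \<in> W {j}" "w \<in> W {j}" for u w
        using proper[of u w] that by (auto simp: W_def)
    qed
    finally show ?thesis .
  qed
  define P where "P = {e. e \<subseteq> {..\<Delta>} \<and> card e = 2}"
  have "\<exists>l r :: bool \<Rightarrow> 'a \<Rightarrow> real. (\<forall>b. \<forall>v\<in>W e. l b v \<le> r b v) \<and>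
      (\<forall>u\<in>W e. \<forall>v\<in>W e. u \<noteq> v \<longrightarrow> ((u, v) \<in> ?E \<longleftrightarrow> (\<forall>b. l b u \<le> r b v \<and> l b v \<le> r b u)))"
    if "e \<in> P" for e
    using that by (intro boxicity_two_if_degree_le_two fin_W E deg) (auto simp: P_def)
  then obtain l r :: "nat set \<Rightarrow> bool \<Rightarrow> 'a \<Rightarrow> real"
    where lr: "\<And>e b v. e \<in> P \<Longrightarrow> v \<in> W e \<Longrightarrow> l e b v \<le> r e b v"
      and box: "\<And>e u v. e \<in> P \<Longrightarrow> u \<in> W e \<Longrightarrow> v \<in> W e \<Longrightarrow> u \<noteq> v \<Longrightarrow>
        (u, v) \<in> ?E \<longleftrightarrow> (\<forall>b. l e b u \<le> r e b v \<and> l e b v \<le> r e b u)"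
    by metis
  \<comment> \<open>The two dimensions become separate graphs, so each pair of colours contributes
    two.\<close>
  define I where "I = (\<lambda>(e, b). interval_extension ?V (W e) (l e b) (r e b))"
  define S where "S = P \<times> (UNIV :: bool set)"
  have pair_in_P: "\<exists>e\<in>P. c u \<in> e \<and> c v \<in> e" if "u \<in> ?V" "v \<in> ?V" for u v
  proof (cases "c u = c v")
    case True
    \<comment> \<open>Equally coloured vertices also need a pair that covers both; \<Delta> \<ge> 1
      supplies a second colour to complete it.\<close>
    obtain k where "k \<le> \<Delta>" "k \<noteq> c u" using \<open>\<Delta> \<ge> 1\<close> by (metis zero_le zero_neq_one)
    then have "{c u, k} \<in> P" using c[OF that(1)] by (simp add: P_def)
    then show ?thesis by (rule bexI[rotated]) (simp add: True)
  next
    case False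
    then have "{c u, c v} \<in> P" using c that by (simp add: P_def)
    then show ?thesis by (rule bexI[rotated]) simp
  qed
  have "{0, 1} \<in> P" using \<open>\<Delta> \<ge> 1\<close> by (auto simp: P_def)
  then have S: "S \<noteq> {}" by (auto simp: S_def)
  have "finite P" unfolding P_def by (rule finite_subset[of _ "Pow {..\<Delta>}"]) auto
  then have fin_S: "finite S" by (simp add: S_def)
  have "(u, v) \<in> ?E \<longleftrightarrow> (\<forall>s\<in>S. (u, v) \<in> parcs (I s))" for u v
  proof
    assume uv: "(u, v) \<in> ?E"
    then have "u \<in> ?V" "v \<in> ?V" "u \<noteq> v"
      using in_arcsD1 in_arcsD2 pair_no_loops[OF uv] by auto
    \<comment> \<open>If both endpoints lie in \<open>W e\<close>, \<open>box\<close> keeps the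
      edge; otherwise one of them is universal in the extension.\<close>
    then show "\<forall>s\<in>S. (u, v) \<in> parcs (I s)"
      using uv box by (auto simp: S_def I_def interval_extension_def)
  next
    assume *: "\<forall>s\<in>S. (u, v) \<in> parcs (I s)"
    then have uv: "u \<in> ?V" "v \<in> ?V" "u \<noteq> v"
      using S by (auto simp: S_def I_def interval_extension_def)
    \<comment> \<open>For a pair \<open>e\<close> containing both colours, the graphs
      \<open>I (e, True)\<close> and \<open>I (e, False)\<close> jointly impose the exact adjacency
      of \<open>G\<close> on \<open>W e\<close>.\<close>
    then obtain e where e: "e \<in> P" "u \<in> W e" "v \<in> W e" using pair_in_P by (auto simp: W_def)
    then have "\<forall>b. (u, v) \<in> parcs (I (e, b))" using * by (simp add: S_def)
    then show "(u, v) \<in> ?E"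
      using e uv box[of e u v] by (auto simp: I_def interval_extension_def)
  qed
  then have inter: "?E = (\<Inter>s\<in>S. parcs (I s))" by auto
  show ?thesis
  proof (rule lbox_le_of_finite_family[OF fin_S S _ _ inter])
    show "0 < 2 * \<Delta>" using \<open>\<Delta> \<ge> 1\<close> by simp
    show "pverts (I s) = ?V" for s by (auto simp: I_def interval_extension_def split: prod.split)
    show "interval_graph (I s)" if "s \<in> S" for s
      using that lr pair_finite_verts
      by (auto simp: I_def S_def intro: interval_graph_interval_extension)
    show "card {s \<in> S. \<not> universal (I s) v} \<le> 2 * \<Delta>" if "v \<in> ?V" for v
    proof -
      let ?T = "{(e, b :: bool). e \<subseteq> {..\<Delta>} \<and> card e = 2 \<and> c v \<in> e}"
      have "?T \<subseteq> S" by (auto simp: S_def P_def)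
      \<comment> \<open>A vertex whose colour is not in \<open>e\<close> lies outside
        \<open>W e\<close>, so only the \<Delta> pairs through its own colour count.\<close>
      moreover have "universal (I (e, b)) v" if "c v \<notin> e" for e b
        using that \<open>v \<in> ?V\<close> by (simp add: I_def W_def universal_interval_extension)
      then have "{s \<in> S. \<not> universal (I s) v} \<subseteq> ?T"
        by (auto simp: S_def P_def)
      ultimately have "card {s \<in> S. \<not> universal (I s) v} \<le> card ?T"
        using fin_S by (meson card_mono finite_subset)
      also have "\<dots> \<le> 2 * \<Delta>" using card_doubletons_containing_le[of "c v" "{..\<Delta>}"] c that by simp
      finally show ?thesis .
    qed
  qed
qed

end
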